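(* Let $D$ be a non-zero $n\times n$ generalized Euclidean distance matrix. Then $\mathrm{null}(D)\subseteq \mathbf{1}^{\perp}$; that is, if $x\in\mathbb{R}^n$ satisfies $Dx=0$, then $\mathbf{1}'x=0$.
   Context: All matrices are real; a prime denotes transpose. $\mathbf{1}\in\mathbb{R}^n$ is the vector of all ones and $\mathbf{1}^\perp$ is the subspace of vectors orthogonal to $\mathbf{1}$. $\mathrm{null}(D)$ is the null space of $D$. An $n\times n$ real symmetric matrix $L$ is a generalized Laplacian matrix if $L$ is positive semidefinite and $L\mathbf{1}=0$. An $n\times n$ matrix $D=[d_{ij}]$ is a generalized Euclidean distance matrix if there exist real numbers $a,b>0$ and an $n\times n$ generalized Laplacian matrix $L=[l_{ij}]$ such that $d_{ij}=a^2 l_{ii}+b^2 l_{jj}-2ab\,l_{ij}$ for all $i,j$. *)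

theory Defs
  imports "HOL-Analysis.Analysis"
begin

definition pos_semidef :: "real^'n^'n \<Rightarrow> bool" where
  "pos_semidef A \<longleftrightarrow> (\<forall>x. 0 \<le> x \<bullet> (A *v x))"

(* The 1 below is the all-ones vector (the unit of componentwise multiplication on vectors). *)
definition generalized_Laplacian :: "real^'n^'n \<Rightarrow> bool" where
  "generalized_Laplacian L \<longleftrightarrow> transpose L = L \<and> pos_semidef L \<and> L *v 1 = 0"

definition generalized_EDM :: "real^'n^'n \<Rightarrow> bool" where
  "generalized_EDM D \<longleftrightarrow>
    (\<exists>(a::real) (b::real) (L::real^'n^'n). a > 0 \<and> b > 0 \<and> generalized_Laplacian L \<and>
      (\<forall>i j. D $ i $ j = a\<^sup>2 * L $ i $ i + b\<^sup>2 * L $ j $ j - 2 * a * b * L $ i $ j))"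

definition null_space :: "real^'n^'m \<Rightarrow> (real^'n) set" where
  "null_space A = {x. A *v x = 0}"

end

theory Submission
  imports Defs
begin

text \<open>
  Let \<open>u\<close> be the diagonal of \<open>L\<close>, \<open>s = \<one>'x\<close> and \<open>Dx = 0\<close>. Pairing \<open>Dx\<close> with \<open>x\<close> gives
  \<open>(a\<^sup>2 + b\<^sup>2) s (u'x) = 2ab x'Lx \<ge> 0\<close>, while pairing it with \<open>\<one>\<close> gives
  \<open>n b\<^sup>2 (u'x) = - a\<^sup>2 tr(L) s\<close>. Hence \<open>tr(L) s\<^sup>2 \<le> 0\<close>, and \<open>tr(L) > 0\<close> because a positive
  semidefinite matrix with zero diagonal vanishes.
\<close>

lemma inner_transpose_matrix_vector:
  fixes A :: "real^'n^'m"
  shows "x \<bullet> (A *v y) = (transpose A *v x) \<bullet> y"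
  by (simp add: dot_lmul_matrix)

lemma pos_semidef_diag_nonneg:
  fixes A :: "real^'n^'n"
  assumes "pos_semidef A"
  shows "0 \<le> A $ i $ i"
proof -
  have "0 \<le> axis i 1 \<bullet> (A *v axis i 1)"
    using assms by (simp add: pos_semidef_def)
  then show ?thesis
    by (simp add: matrix_vector_mult_basis column_def inner_axis')
qed

text \<open>With zero diagonal, the quadratic form at \<open>axis i 1 - t *\<^sub>R axis j 1\<close>
  is linear in \<open>t\<close>, namely \<open>- 2 * t * A $ i $ j\<close>. Taking
  \<open>t = A $ i $ j\<close> makes it negative unless that entry vanishes.\<close>

lemma pos_semidef_diag_zero_imp_zero:
  fixes A :: "real^'n^'n"
  assumes sym: "transpose A = A" and psd: "pos_semidef A" and diag: "\<And>i. A $ i $ i = 0"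
  shows "A = 0"
proof -
  have "A $ i $ j = 0" for i j
  proof -
    define x :: "real^'n" where "x = axis i 1 - (A $ i $ j) *\<^sub>R axis j 1"
    have "A $ j $ i = A $ i $ j"
      using sym by (metis transpose_def vec_lambda_beta)
    then have "x \<bullet> (A *v x) = - 2 * (A $ i $ j)\<^sup>2"
      by (simp add: x_def matrix_vector_mult_diff_distrib matrix_vector_mult_scaleR
          matrix_vector_mult_basis column_def inner_axis' inner_diff_left inner_diff_right
          diag power2_eq_square)
    moreover have "0 \<le> x \<bullet> (A *v x)"
      using psd by (simp add: pos_semidef_def)
    ultimately show ?thesis by simp
  qed
  then show ?thesis by (simp add: vec_eq_iff)
qed

theorem theorem2p5:
  fixes D :: "real^'n^'n"
  assumes "generalized_EDM D" and "D \<noteq> 0"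
  shows "null_space D \<subseteq> orthogonal_comp {1}"
proof
  fix x assume "x \<in> null_space D"
  then have Dx: "D *v x = 0" by (simp add: null_space_def)
  obtain a b :: real and L :: "real^'n^'n" where ab: "a > 0" "b > 0"
    and L: "transpose L = L" "pos_semidef L" "L *v 1 = 0"
    and D: "\<And>i j. D $ i $ j = a\<^sup>2 * L $ i $ i + b\<^sup>2 * L $ j $ j - 2 * a * b * L $ i $ j"
    using assms(1) unfolding generalized_EDM_def generalized_Laplacian_def by blast
  define u :: "real^'n" where "u = (\<chi> i. L $ i $ i)"
  define s where "s = 1 \<bullet> x"
  \<comment> \<open>In matrix form, D = a^2 u 1' + b^2 1 u' - 2ab L.\<close>
  have "D *v x = (a\<^sup>2 * s) *\<^sub>R u + (b\<^sup>2 * (u \<bullet> x)) *\<^sub>R 1 - (2 * a * b) *\<^sub>R (L *v x)"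
    by (simp add: vec_eq_iff matrix_vector_mult_def D u_def s_def inner_vec_def
        sum_distrib_left sum_distrib_right sum_subtractf sum.distrib algebra_simps)
  then have eq: "(a\<^sup>2 * s) *\<^sub>R u + (b\<^sup>2 * (u \<bullet> x)) *\<^sub>R 1 = (2 * a * b) *\<^sub>R (L *v x)"
    using Dx by simp
  \<comment> \<open>Symmetry moves \<open>L\<close> onto the all-ones vector, which it
    annihilates.\<close>
  have "1 \<bullet> (L *v x) = 0"
    using L by (simp add: inner_transpose_matrix_vector)
  moreover have "(1 :: real^'n) \<bullet> 1 = CARD('n)"
    by (simp add: inner_vec_def)
  ultimately have pair_1: "a\<^sup>2 * s * (1 \<bullet> u) + b\<^sup>2 * (u \<bullet> x) * CARD('n) = 0"
    using arg_cong[OF eq, of "inner 1"] by (simp add: inner_add_right)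
  have pair_x: "(a\<^sup>2 + b\<^sup>2) * (s * (u \<bullet> x)) = 2 * a * b * (x \<bullet> (L *v x))"
    using arg_cong[OF eq, of "inner x"]
    by (simp add: inner_add_right inner_commute s_def algebra_simps)
  have "0 \<le> 2 * a * b * (x \<bullet> (L *v x))"
    using ab L(2) by (simp add: pos_semidef_def)
  then have "0 \<le> (a\<^sup>2 + b\<^sup>2) * (s * (u \<bullet> x))"
    using pair_x by simp
  moreover have "0 < a\<^sup>2 + b\<^sup>2"
    using ab by (simp add: add_pos_pos)
  ultimately have "0 \<le> s * (u \<bullet> x)"
    by (simp add: zero_le_mult_iff)
  \<comment> \<open>This factor matches the coefficient of \<open>u \<bullet> x\<close> in
    \<open>pair_1\<close>, so that \<open>s\<close> times \<open>pair_1\<close> trades the product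
    for a nonpositive multiple of \<open>s\<^sup>2\<close> without any division.\<close>
  then have "0 \<le> (b\<^sup>2 * CARD('n)) * (s * (u \<bullet> x))"
    by simp
  also have "\<dots> = - (a\<^sup>2 * (1 \<bullet> u) * s\<^sup>2)"
    using arg_cong[OF pair_1, of "(*) s"] by (simp add: power2_eq_square algebra_simps)
  finally have le: "a\<^sup>2 * (1 \<bullet> u) * s\<^sup>2 \<le> 0" by simp
  have "L \<noteq> 0"
  proof
    assume "L = 0"
    then have "D = 0" by (simp add: vec_eq_iff D)
    with \<open>D \<noteq> 0\<close> show False ..
  qed
  then obtain i where "L $ i $ i \<noteq> 0"
    using pos_semidef_diag_zero_imp_zero L by blast
  \<comment> \<open>This sum is the trace of \<open>L\<close>, which equals
    \<open>1 \<bullet> u\<close>; its terms are nonnegative and the one at \<open>i\<close> is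
    nonzero.\<close>
  then have "0 < (\<Sum>i\<in>UNIV. L $ i $ i)"
    using pos_semidef_diag_nonneg[OF L(2)]
    by (intro sum_pos2[of _ i]) (auto simp: less_le)
  then have "0 < a\<^sup>2 * (1 \<bullet> u)"
    using ab by (simp add: inner_vec_def u_def)
  with le have "s = 0"
    by (metis mult_pos_pos not_le zero_less_power2)
  then show "x \<in> orthogonal_comp {1}"
    by (simp add: orthogonal_comp_def orthogonal_def s_def)
qed

end
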